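(* Let $n$ be a positive integer and let $(i,\sigma),(j,\tau)\in Q\mathfrak{S}_n$. Then the following conditions are equivalent: (1) There exists $\alpha\in\mathfrak{S}_n$ such that $j=i^\alpha$ and $\tau=\alpha^{-1}\sigma\alpha$. (2) $\lambda(\sigma)=\lambda(\tau)$ and $d(i,\sigma)=d(j,\tau)$. (3) $(i,\sigma)$ and $(j,\tau)$ belong to the same connected component of $Q\mathfrak{S}_n$.
   Context: Let $[n]=\{1,\dots,n\}$ and let $\mathfrak{S}_n$ be the symmetric group on $[n]$, with permutations multiplied from left to right ($\sigma\tau:=\tau\circ\sigma$), so that $i^\sigma:=\sigma(i)$ is a right action. $Q\mathfrak{S}_n$ is the quandle with underlying set $[n]\times\mathfrak{S}_n$ and operation $(i,\sigma)\triangleleft(j,\tau):=(i^{\sigma^{-1}\tau},\tau^{-1}\sigma\tau)$. For a quandle $Q$ and $y\in Q$, the point symmetry $s_y(x):=x\triangleleft y$ is an automorphism of $Q$; $\mathrm{Inn}(Q)$ is the group generated by all $s_y$, and the connected components of $Q$ are the $\mathrm{Inn}(Q)$-orbits. The cycle type $\lambda(\sigma)$ of $\sigma\in\mathfrak{S}_n$ is the partition $(1^{m_1}2^{m_2}\cdots n^{m_n})$ of $n$, where $m_k$ is the number of cycles of length $k$ (including fixed points for $k=1$) in the cycle decomposition of $\sigma$. For $i\in[n]$, $d(i,\sigma)$ is the length of the cycle of $\sigma$ containing $i$. *)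

theory Defs
  imports
    "HOL-Algebra.Group_Action"
    "HOL-Algebra.Generated_Groups"
    "HOL-Combinatorics.Orbits"
    "HOL-Library.Multiset"
begin

text \<open>
  Both Group_Action and Orbits define a constant called orbit; the unqualified name refers to
  the orbit of a point under a single function. From here on, inv is the inverse of a function.
\<close>

hide_const (open) Group_Action.orbit
unbundle no m_inv_syntax

section \<open>Quandles, inner automorphisms and connected components\<close>

locale quandle =
  fixes Q :: "'a set" and tri :: "'a \<Rightarrow> 'a \<Rightarrow> 'a"
  assumes closed: "x \<in> Q \<Longrightarrow> y \<in> Q \<Longrightarrow> tri x y \<in> Q"
    and idem: "x \<in> Q \<Longrightarrow> tri x x = x"
    and bij: "y \<in> Q \<Longrightarrow> bij_betw (\<lambda>x. tri x y) Q Q"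
    and distrib: "x \<in> Q \<Longrightarrow> y \<in> Q \<Longrightarrow> z \<in> Q \<Longrightarrow>
      tri (tri x y) z = tri (tri x z) (tri y z)"

definition point_symmetry :: "'a set \<Rightarrow> ('a \<Rightarrow> 'a \<Rightarrow> 'a) \<Rightarrow> 'a \<Rightarrow> 'a \<Rightarrow> 'a" where
  "point_symmetry Q tri y = (\<lambda>x\<in>Q. tri x y)"

lemma (in quandle) point_symmetry_Bij: "y \<in> Q \<Longrightarrow> point_symmetry Q tri y \<in> Bij Q"
  using bij by (auto simp: point_symmetry_def Bij_def cong: bij_betw_cong)

definition Inn :: "'a set \<Rightarrow> ('a \<Rightarrow> 'a \<Rightarrow> 'a) \<Rightarrow> ('a \<Rightarrow> 'a) monoid" where
  "Inn Q tri = (BijGroup Q)\<lparr>carrier := generate (BijGroup Q) (point_symmetry Q tri ` Q)\<rparr>"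

definition connected_components :: "'a set \<Rightarrow> ('a \<Rightarrow> 'a \<Rightarrow> 'a) \<Rightarrow> 'a set set" where
  "connected_components Q tri = orbits (Inn Q tri) Q (\<lambda>f. f)"

section \<open>Permutations and cycle types\<close>

text \<open>Permutations are multiplied from left to right.\<close>

abbreviation perm_mult :: "('a \<Rightarrow> 'a) \<Rightarrow> ('a \<Rightarrow> 'a) \<Rightarrow> 'a \<Rightarrow> 'a" (infixl "\<cdot>" 70) where
  "\<sigma> \<cdot> \<tau> \<equiv> \<tau> \<circ> \<sigma>"

definition Sym :: "nat \<Rightarrow> (nat \<Rightarrow> nat) set" where
  "Sym n = {\<sigma>. \<sigma> permutes {1..n}}"

text \<open>A cycle is represented by its set of points; a fixed point gives a singleton.\<close>

definition cycle_sets :: "nat \<Rightarrow> (nat \<Rightarrow> nat) \<Rightarrow> nat set set" where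
  "cycle_sets n \<sigma> = {orbit \<sigma> i | i. i \<in> {1..n}}"

definition num_cycles :: "nat \<Rightarrow> (nat \<Rightarrow> nat) \<Rightarrow> nat \<Rightarrow> nat" where
  "num_cycles n \<sigma> k = card {C \<in> cycle_sets n \<sigma>. card C = k}"

text \<open>The partition $(1^{m_1} 2^{m_2} \cdots n^{m_n})$ is the multiset of its parts.\<close>

definition cycle_type :: "nat \<Rightarrow> (nat \<Rightarrow> nat) \<Rightarrow> nat multiset" where
  "cycle_type n \<sigma> = (\<Sum>k\<in>{1..n}. replicate_mset (num_cycles n \<sigma> k) k)"

definition cycle_length :: "nat \<Rightarrow> (nat \<Rightarrow> nat) \<Rightarrow> nat" where
  "cycle_length i \<sigma> = card (orbit \<sigma> i)"

section \<open>The quandle on $[n] \times S_n$\<close>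

definition QS :: "nat \<Rightarrow> (nat \<times> (nat \<Rightarrow> nat)) set" where
  "QS n = {1..n} \<times> Sym n"

fun QS_op :: "nat \<times> (nat \<Rightarrow> nat) \<Rightarrow> nat \<times> (nat \<Rightarrow> nat) \<Rightarrow> nat \<times> (nat \<Rightarrow> nat)"
  where "QS_op (i, \<sigma>) (j, \<tau>) = ((inv \<sigma> \<cdot> \<tau>) i, inv \<tau> \<cdot> \<sigma> \<cdot> \<tau>)"

lemma quandle_QS: "quandle (QS n) QS_op"
proof
  show cl: "QS_op x y \<in> QS n" if "x \<in> QS n" "y \<in> QS n" for x y
  proof -
    obtain i \<sigma> j \<tau> where xy: "x = (i, \<sigma>)" "y = (j, \<tau>)" by (metis surj_pair)
    have p: "\<sigma> permutes {1..n}" "\<tau> permutes {1..n}" "i \<in> {1..n}"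
      using that xy by (auto simp: QS_def Sym_def)
    have "inv \<sigma> \<cdot> \<tau> permutes {1..n}" "inv \<tau> \<cdot> \<sigma> \<cdot> \<tau> permutes {1..n}"
      using p by (auto intro!: permutes_compose permutes_inv)
    then show ?thesis
      using p(3) permutes_in_image unfolding xy QS_def Sym_def by fastforce
  qed
  show "QS_op x x = x" if "x \<in> QS n" for x
    using that by (cases x) (auto simp: QS_def Sym_def permutes_inverses fun_eq_iff)
  show "QS_op (QS_op x y) z = QS_op (QS_op x z) (QS_op y z)"
    if "x \<in> QS n" "y \<in> QS n" "z \<in> QS n" for x y z
  proof -
    obtain i \<sigma> j \<tau> k \<rho> where xyz: "x = (i, \<sigma>)" "y = (j, \<tau>)" "z = (k, \<rho>)"
      by (metis surj_pair)
    have p: "\<sigma> permutes {1..n}" "\<tau> permutes {1..n}" "\<rho> permutes {1..n}"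
      using that xyz by (auto simp: QS_def Sym_def)
    note b = p[THEN permutes_bij]
    have "inv (inv \<tau> \<cdot> \<sigma> \<cdot> \<tau>) = inv \<tau> \<cdot> inv \<sigma> \<cdot> \<tau>"
      "inv (inv \<rho> \<cdot> \<sigma> \<cdot> \<rho>) = inv \<rho> \<cdot> inv \<sigma> \<cdot> \<rho>"
      "inv (inv \<rho> \<cdot> \<tau> \<cdot> \<rho>) = inv \<rho> \<cdot> inv \<tau> \<cdot> \<rho>"
      using b by (simp_all add: o_inv_distrib bij_imp_bij_inv bij_comp inv_inv_eq comp_assoc)
    then show ?thesis
      using p by (simp add: xyz fun_eq_iff permutes_inverses)
  qed
  show "bij_betw (\<lambda>x. QS_op x y) (QS n) (QS n)" if y: "y \<in> QS n" for y
  proof -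
    obtain j \<tau> where yj: "y = (j, \<tau>)" by (metis surj_pair)
    have t: "\<tau> permutes {1..n}" using y yj by (auto simp: QS_def Sym_def)
    define g where
      "g = (\<lambda>(i, \<sigma>). ((inv \<tau> \<cdot> (\<tau> \<cdot> \<sigma> \<cdot> inv \<tau>)) i, \<tau> \<cdot> \<sigma> \<cdot> inv \<tau>))"
    have g: "g x \<in> QS n" if "x \<in> QS n" for x
    proof -
      obtain i \<sigma> where x: "x = (i, \<sigma>)" by (metis surj_pair)
      have p: "\<sigma> permutes {1..n}" "i \<in> {1..n}" using that x by (auto simp: QS_def Sym_def)
      have "inv \<tau> \<cdot> (\<tau> \<cdot> \<sigma> \<cdot> inv \<tau>) permutes {1..n}" "\<tau> \<cdot> \<sigma> \<cdot> inv \<tau> permutes {1..n}"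
        using p t by (auto intro!: permutes_compose permutes_inv)
      then show ?thesis
        using p(2) permutes_in_image unfolding x QS_def Sym_def g_def by fastforce
    qed
    show ?thesis
    proof (rule bij_betw_byWitness[where f' = g])
      show "\<forall>x\<in>QS n. g (QS_op x y) = x"
        using t by (auto simp: QS_def Sym_def g_def yj permutes_inverses fun_eq_iff)
      show "\<forall>x\<in>QS n. QS_op (g x) y = x"
      proof
        fix x assume "x \<in> QS n"
        then obtain i \<sigma> where x: "x = (i, \<sigma>)" and s: "\<sigma> permutes {1..n}"
          by (auto simp: QS_def Sym_def)
        have "inv (\<tau> \<cdot> \<sigma> \<cdot> inv \<tau>) = \<tau> \<cdot> inv \<sigma> \<cdot> inv \<tau>"
          using t[THEN permutes_bij] s[THEN permutes_bij]
          by (simp add: o_inv_distrib bij_imp_bij_inv bij_comp inv_inv_eq comp_assoc)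
        then show "QS_op (g x) y = x"
          using t s by (simp add: x yj g_def permutes_inverses fun_eq_iff)
      qed
    qed (use cl y g in blast)+
  qed
qed

end

theory Submission
  imports Defs
begin

text \<open>
  Call a pair \<open>(i, \<sigma>)\<close> a permutation with a marked point. A permutation \<open>\<alpha>\<close> of the labels acts
  on such pairs by \<open>(i, \<sigma>) \<mapsto> (i\<^sup>\<alpha>, \<alpha>\<^sup>-\<^sup>1\<sigma>\<alpha>)\<close>, and the first condition says that the two pairs
  lie in one orbit of this relabelling action. The other two conditions are compared with it.

  The cycle type and the length of the marked cycle are a complete set of invariants of relabelling.
  They are invariant because \<open>\<alpha>\<close> carries the cycles of \<open>\<sigma>\<close> onto those of its conjugate. They
  are complete because equal cycle types give a length-preserving bijection between the cycles of
  \<open>\<sigma>\<close> and those of \<open>\<tau>\<close>; as the marked cycles have equal length, it can be corrected by one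
  transposition so that it pairs them. Paired cycles are identified by stepping along both at the
  same time, starting in the marked cycles from the marked points (this is the lemma
  \<open>orbit_bij_equivariant\<close>), and the union of these identifications is the required relabelling
  (\<open>relabel_if_same_cycle_data\<close>).

  The connected components are exactly the relabelling orbits. The right translation by
  \<open>(j, \<tau>)\<close> sends \<open>(i, \<sigma>)\<close> to its relabelling by \<open>\<sigma>\<^sup>-\<^sup>1\<tau>\<close>, so inner automorphisms do not leave a
  relabelling orbit (\<open>Inn_imp_relabel\<close>). Conversely, the translation by \<open>(j, \<alpha>)\<close> differs from
  relabelling by \<open>\<alpha>\<close> only in a preliminary step of the marked point along \<open>\<sigma>\<^sup>-\<^sup>1\<close>. That step alone
  is the translation by \<open>(j, 1)\<close>, so undoing it first leaves precisely the relabelling by \<open>\<alpha>\<close>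
  (\<open>relabel_by_Inn\<close>).
\<close>

section \<open>Relabelling permutations with a marked point\<close>

fun relabel :: "('a \<Rightarrow> 'a) \<Rightarrow> 'a \<times> ('a \<Rightarrow> 'a) \<Rightarrow> 'a \<times> ('a \<Rightarrow> 'a)" where
  "relabel \<alpha> (i, \<sigma>) = (\<alpha> i, inv \<alpha> \<cdot> \<sigma> \<cdot> \<alpha>)"

lemma relabel_id: "relabel id x = x"
  by (cases x) simp

lemma relabel_relabel:
  assumes "bij \<alpha>" "bij \<beta>"
  shows "relabel \<beta> (relabel \<alpha> x) = relabel (\<alpha> \<cdot> \<beta>) x"
  using assms by (cases x) (simp add: o_inv_distrib comp_assoc)

lemma relabel_inv:
  assumes "bij \<alpha>"
  shows "relabel (inv \<alpha>) (relabel \<alpha> x) = x"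
  using assms
  by (simp add: relabel_relabel bij_imp_bij_inv bij_is_inj relabel_id)

lemma Sym_bij: "\<alpha> \<in> Sym n \<Longrightarrow> bij \<alpha>"
  by (simp add: Sym_def permutes_bij)

lemma Sym_comp: "\<alpha> \<in> Sym n \<Longrightarrow> \<beta> \<in> Sym n \<Longrightarrow> \<alpha> \<cdot> \<beta> \<in> Sym n"
  by (simp add: Sym_def permutes_compose)

lemma Sym_inv: "\<alpha> \<in> Sym n \<Longrightarrow> inv \<alpha> \<in> Sym n"
  by (simp add: Sym_def permutes_inv)

lemma Sym_id: "id \<in> Sym n"
  by (simp add: Sym_def permutes_id)

lemma Sym_permutation: "\<alpha> \<in> Sym n \<Longrightarrow> permutation \<alpha>"
  by (auto simp: Sym_def permutation_permutes)

section \<open>Connected components are relabelling orbits\<close>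

lemma QS_op_eq_relabel:
  assumes "bij \<sigma>" "bij \<tau>"
  shows "QS_op (i, \<sigma>) (j, \<tau>) = relabel (inv \<sigma> \<cdot> \<tau>) (i, \<sigma>)"
proof -
  have "inv (inv \<sigma> \<cdot> \<tau>) = inv \<tau> \<cdot> \<sigma>"
    using assms by (simp add: o_inv_distrib bij_imp_bij_inv inv_inv_eq)
  moreover have "inv \<sigma> \<circ> (\<sigma> \<circ> (\<sigma> \<circ> inv \<tau>)) = \<sigma> \<circ> inv \<tau>"
    using assms by (simp add: fun_eq_iff bij_is_inj)
  ultimately show ?thesis
    by (simp add: comp_assoc)
qed

lemma generate_subset_Bij:
  assumes "H \<subseteq> Bij S" "f \<in> generate (BijGroup S) H"
  shows "f \<in> Bij S"
proof -
  interpret group "BijGroup S" by (rule group_BijGroup)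
  show ?thesis
    using generate_incl[of H] assms by (auto simp: BijGroup_def)
qed

text \<open>
  It suffices to check that the generators respect an equivalence relation: a permutation that
  moves every point within its class has an inverse with the same property.
\<close>

lemma generate_respects_equivalence:
  assumes H: "H \<subseteq> Bij S"
    and refl: "\<And>x. x \<in> S \<Longrightarrow> R x x"
    and sym: "\<And>x y. x \<in> S \<Longrightarrow> y \<in> S \<Longrightarrow> R x y \<Longrightarrow> R y x"
    and trans: "\<And>x y z. x \<in> S \<Longrightarrow> y \<in> S \<Longrightarrow> z \<in> S \<Longrightarrow> R x y \<Longrightarrow> R y z \<Longrightarrow> R x z"
    and gen: "\<And>h x. h \<in> H \<Longrightarrow> x \<in> S \<Longrightarrow> R x (h x)"
    and f: "f \<in> generate (BijGroup S) H"
  shows "x \<in> S \<Longrightarrow> R x (f x)"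
  using f
proof (induction arbitrary: x rule: generate.induct)
  case one
  then show ?case by (simp add: BijGroup_def refl)
next
  case (incl h)
  then show ?case using gen by blast
next
  case (inv h)
  then have h: "h \<in> Bij S" using H by blast
  have mem: "inv_into S h x \<in> S"
    using Bij_inv_into_mem[OF h inv.prems] .
  have "h (inv_into S h x) = x"
    using h inv.prems bij_betw_inv_into_right[of h S S x] by (simp add: Bij_def)
  then have "R (inv_into S h x) x"
    using gen[OF inv.hyps mem] by simp
  then show ?case
    using sym[OF mem inv.prems] inv.prems by (simp add: inv_BijGroup[OF h])
next
  case (eng f g)
  have fg: "f \<in> Bij S" "g \<in> Bij S"
    using generate_subset_Bij[OF H] eng.hyps by blast+
  then have "g x \<in> S" "f (g x) \<in> S"
    using eng.prems Bij_imp_funcset by blast+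
  then have "R x (f (g x))"
    using trans eng by blast
  then show ?case
    using fg eng.prems by (simp add: BijGroup_def compose_def)
qed

lemma point_symmetries_subset_Bij:
  "point_symmetry (QS n) QS_op ` QS n \<subseteq> Bij (QS n)"
  using quandle.point_symmetry_Bij[OF quandle_QS] by blast

lemma Inn_imp_relabel:
  assumes "f \<in> carrier (Inn (QS n) QS_op)" "x \<in> QS n"
  shows "\<exists>\<alpha>\<in>Sym n. f x = relabel \<alpha> x"
proof (rule generate_respects_equivalence[where R = "\<lambda>x y. \<exists>\<alpha>\<in>Sym n. y = relabel \<alpha> x"
      and S = "QS n" and H = "point_symmetry (QS n) QS_op ` QS n"])
  show "point_symmetry (QS n) QS_op ` QS n \<subseteq> Bij (QS n)"
    by (rule point_symmetries_subset_Bij)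
  show "\<exists>\<alpha>\<in>Sym n. x = relabel \<alpha> x" for x :: "nat \<times> (nat \<Rightarrow> nat)"
    using Sym_id relabel_id by metis
  show "\<exists>\<alpha>\<in>Sym n. x = relabel \<alpha> y" if "\<exists>\<alpha>\<in>Sym n. y = relabel \<alpha> x"
    for x y :: "nat \<times> (nat \<Rightarrow> nat)"
    using that Sym_inv Sym_bij relabel_inv by metis
  show "\<exists>\<alpha>\<in>Sym n. z = relabel \<alpha> x"
    if "\<exists>\<alpha>\<in>Sym n. y = relabel \<alpha> x" "\<exists>\<alpha>\<in>Sym n. z = relabel \<alpha> y"
    for x y z :: "nat \<times> (nat \<Rightarrow> nat)"
    using that Sym_comp Sym_bij relabel_relabel by metis
  show "\<exists>\<alpha>\<in>Sym n. h x = relabel \<alpha> x"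
    if gen: "h \<in> point_symmetry (QS n) QS_op ` QS n" and x: "x \<in> QS n" for h x
  proof -
    obtain i \<sigma> j \<tau> where h: "h = point_symmetry (QS n) QS_op (j, \<tau>)"
      and xy: "x = (i, \<sigma>)" "\<sigma> \<in> Sym n" "\<tau> \<in> Sym n"
      using gen x by (auto simp: QS_def)
    then have "h x = relabel (inv \<sigma> \<cdot> \<tau>) x"
      using x by (simp add: point_symmetry_def QS_op_eq_relabel Sym_bij
          del: relabel.simps QS_op.simps)
    then show ?thesis
      using xy Sym_comp Sym_inv by blast
  qed
  show "f \<in> generate (BijGroup (QS n)) (point_symmetry (QS n) QS_op ` QS n)"
    using assms(1) by (simp add: Inn_def)
qed (rule assms(2))

lemma relabel_by_Inn:
  assumes x: "x \<in> QS n" and \<alpha>: "\<alpha> \<in> Sym n"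
  shows "\<exists>f\<in>carrier (Inn (QS n) QS_op). f x = relabel \<alpha> x"
proof -
  obtain i \<sigma> where xi: "x = (i, \<sigma>)" and i: "i \<in> {1..n}" and \<sigma>: "\<sigma> \<in> Sym n"
    using x by (auto simp: QS_def)
  define s where "s = point_symmetry (QS n) QS_op (i, id)"
  define t where "t = point_symmetry (QS n) QS_op (i, \<alpha>)"
  define f where "f = t \<otimes>\<^bsub>BijGroup (QS n)\<^esub> (m_inv (BijGroup (QS n)) s)"
  have mem: "(i, id) \<in> QS n" "(i, \<alpha>) \<in> QS n"
    using i \<alpha> Sym_id by (auto simp: QS_def)
  then have Bij: "s \<in> Bij (QS n)" "t \<in> Bij (QS n)"
    unfolding s_def t_def using point_symmetries_subset_Bij by blast+
  have "f \<in> carrier (Inn (QS n) QS_op)"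
    using mem by (auto simp: Inn_def f_def s_def t_def intro: generate.intros)
  moreover have "f x = relabel \<alpha> x"
  proof -
    have y: "(\<sigma> i, \<sigma>) \<in> QS n"
      using i \<sigma> permutes_in_image[of \<sigma> "{1..n}" i] by (auto simp: QS_def Sym_def)
    have inj: "inv \<sigma> (\<sigma> i) = i"
      using \<sigma> Sym_bij bij_is_inj inv_f_f by metis
    have "s (\<sigma> i, \<sigma>) = x"
      using y inj by (simp add: s_def point_symmetry_def xi)
    then have "inv_into (QS n) s x = (\<sigma> i, \<sigma>)"
      using Bij(1) y by (auto simp: Bij_def bij_betw_inv_into_left)
    moreover have "t (\<sigma> i, \<sigma>) = relabel \<alpha> x"
      using y inj by (simp add: t_def point_symmetry_def xi)
    moreover have "restrict (inv_into (QS n) s) (QS n) \<in> Bij (QS n)"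
      using Bij(1) by (rule restrict_inv_into_Bij)
    ultimately show ?thesis
      using Bij x unfolding f_def inv_BijGroup[OF Bij(1)]
      by (simp add: BijGroup_def compose_def)
  qed
  ultimately show ?thesis by blast
qed

lemma same_component_iff_relabel:
  assumes x: "x \<in> QS n" and y: "y \<in> QS n"
  shows "(\<exists>C\<in>connected_components (QS n) QS_op. x \<in> C \<and> y \<in> C)
    \<longleftrightarrow> (\<exists>\<alpha>\<in>Sym n. y = relabel \<alpha> x)"
proof
  assume "\<exists>C\<in>connected_components (QS n) QS_op. x \<in> C \<and> y \<in> C"
  then obtain z f g where z: "z \<in> QS n"
    and fg: "f \<in> carrier (Inn (QS n) QS_op)" "g \<in> carrier (Inn (QS n) QS_op)"
    and "x = f z" "y = g z"
    by (auto simp: connected_components_def orbits_def Group_Action.orbit_def)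
  then obtain \<alpha> \<beta> where \<alpha>: "\<alpha> \<in> Sym n" "x = relabel \<alpha> z" and \<beta>: "\<beta> \<in> Sym n" "y = relabel \<beta> z"
    using Inn_imp_relabel by metis
  have "relabel (inv \<alpha>) x = z"
    using \<alpha> Sym_bij relabel_inv by metis
  then have "y = relabel (inv \<alpha> \<cdot> \<beta>) x"
    using \<alpha>(1) \<beta> Sym_inv Sym_bij relabel_relabel by metis
  then show "\<exists>\<alpha>\<in>Sym n. y = relabel \<alpha> x"
    using \<alpha>(1) \<beta>(1) Sym_inv Sym_comp by blast
next
  assume "\<exists>\<alpha>\<in>Sym n. y = relabel \<alpha> x"
  then obtain f where f: "f \<in> carrier (Inn (QS n) QS_op)" "f x = y"
    using relabel_by_Inn[OF x] by metis
  obtain e where e: "e \<in> carrier (Inn (QS n) QS_op)" "e x = x"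
    using relabel_by_Inn[OF x Sym_id] relabel_id by metis
  let ?C = "Group_Action.orbit (Inn (QS n) QS_op) (\<lambda>f. f) x"
  have "?C \<in> connected_components (QS n) QS_op"
    using x unfolding connected_components_def orbits_def by blast
  moreover have "e x \<in> ?C" "f x \<in> ?C"
    using e(1) f(1) unfolding Group_Action.orbit_def by blast+
  ultimately show "\<exists>C\<in>connected_components (QS n) QS_op. x \<in> C \<and> y \<in> C"
    unfolding e(2) f(2) by blast
qed

section \<open>Relabelling preserves cycle lengths\<close>

lemma orbit_conjugate:
  assumes "permutation \<sigma>" "bij \<alpha>"
  shows "orbit (inv \<alpha> \<cdot> \<sigma> \<cdot> \<alpha>) (\<alpha> x) = \<alpha> ` orbit \<sigma> x"
proof -
  have "\<alpha> ` orbit \<sigma> x = orbit (inv \<alpha> \<cdot> \<sigma> \<cdot> \<alpha>) (\<alpha> x)"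
    by (rule orbit_inverse) (use assms in \<open>simp_all add: permutation_self_in_orbit bij_is_inj\<close>)
  then show ?thesis ..
qed

lemma cycle_sets_eq_image: "cycle_sets n \<sigma> = orbit \<sigma> ` {1..n}"
  unfolding cycle_sets_def by blast

lemma cycle_sets_conjugate:
  assumes "\<sigma> \<in> Sym n" "\<alpha> \<in> Sym n"
  shows "cycle_sets n (inv \<alpha> \<cdot> \<sigma> \<cdot> \<alpha>) = (`) \<alpha> ` cycle_sets n \<sigma>"
proof -
  have "cycle_sets n (inv \<alpha> \<cdot> \<sigma> \<cdot> \<alpha>) = orbit (inv \<alpha> \<cdot> \<sigma> \<cdot> \<alpha>) ` \<alpha> ` {1..n}"
    using assms(2) permutes_image[of \<alpha> "{1..n}"]
    by (simp add: cycle_sets_eq_image Sym_def)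
  also have "\<dots> = (`) \<alpha> ` orbit \<sigma> ` {1..n}"
    using orbit_conjugate[OF Sym_permutation[OF assms(1)] Sym_bij[OF assms(2)]]
    by (simp add: image_image)
  finally show ?thesis
    by (simp add: cycle_sets_eq_image)
qed

lemma num_cycles_conjugate:
  assumes "\<sigma> \<in> Sym n" "\<alpha> \<in> Sym n"
  shows "num_cycles n (inv \<alpha> \<cdot> \<sigma> \<cdot> \<alpha>) k = num_cycles n \<sigma> k"
proof -
  have inj: "inj \<alpha>"
    using assms(2) by (simp add: Sym_bij bij_is_inj)
  have card: "card (\<alpha> ` C) = card C" for C
    using inj by (simp add: card_image inj_on_subset)
  have "{C \<in> cycle_sets n (inv \<alpha> \<cdot> \<sigma> \<cdot> \<alpha>). card C = k}
      = (`) \<alpha> ` {C \<in> cycle_sets n \<sigma>. card C = k}"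
    unfolding cycle_sets_conjugate[OF assms] using card by auto
  moreover have "inj_on ((`) \<alpha>) A" for A
    using inj by (simp add: inj_on_def inj_image_eq_iff)
  ultimately show ?thesis
    by (simp add: num_cycles_def card_image)
qed

lemma same_cycle_data_if_relabel:
  assumes "\<sigma> \<in> Sym n" "\<alpha> \<in> Sym n" "(j, \<tau>) = relabel \<alpha> (i, \<sigma>)"
  shows "cycle_type n \<sigma> = cycle_type n \<tau> \<and> cycle_length i \<sigma> = cycle_length j \<tau>"
proof -
  have "inj_on \<alpha> (orbit \<sigma> i)"
    using Sym_bij[OF assms(2)] bij_is_inj inj_on_subset by blast
  then show ?thesis
    using assms orbit_conjugate[OF Sym_permutation Sym_bij]
    by (simp add: cycle_type_def num_cycles_conjugate cycle_length_def card_image)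
qed

section \<open>Reconstructing a relabelling from cycle lengths\<close>

lemma count_cycle_type:
  assumes "k \<in> {1..n}"
  shows "count (cycle_type n \<sigma>) k = num_cycles n \<sigma> k"
proof -
  have "count (cycle_type n \<sigma>) k = (\<Sum>l\<in>{1..n}. if l = k then num_cycles n \<sigma> l else 0)"
    unfolding cycle_type_def count_sum by (intro sum.cong) auto
  then show ?thesis
    using assms by (simp add: sum.delta)
qed

lemma card_cycle_in_range:
  assumes "\<sigma> \<in> Sym n" "C \<in> cycle_sets n \<sigma>"
  shows "card C \<in> {1..n}"
proof -
  obtain x where x: "x \<in> {1..n}" "C = orbit \<sigma> x"
    using assms(2) by (auto simp: cycle_sets_def)
  then have sub: "C \<subseteq> {1..n}"
    using assms(1) permutes_orbit_subset[of \<sigma> "{1..n}" x] by (simp add: Sym_def)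
  have "C \<noteq> {}"
    using x orbit_nonempty by metis
  then have "card C \<noteq> 0"
    using sub finite_subset by fastforce
  then show ?thesis
    using card_mono[OF _ sub] by simp
qed

lemma num_cycles_eq_if_cycle_type_eq:
  assumes "\<sigma> \<in> Sym n" "\<tau> \<in> Sym n" "cycle_type n \<sigma> = cycle_type n \<tau>"
  shows "num_cycles n \<sigma> k = num_cycles n \<tau> k"
proof (cases "k \<in> {1..n}")
  case True
  then show ?thesis using assms(3) count_cycle_type by metis
next
  case False
  then have none: "{C \<in> cycle_sets n \<pi>. card C = k} = {}" if "\<pi> \<in> Sym n" for \<pi>
    using card_cycle_in_range[OF that] by blast
  show ?thesis
    by (simp only: num_cycles_def none[OF assms(1)] none[OF assms(2)])
qed

lemma ex_bij_betw_preserving: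
  assumes fin: "finite A" "finite B"
    and fibres: "\<And>k. card {a \<in> A. f a = k} = card {b \<in> B. g b = k}"
  shows "\<exists>F. bij_betw F A B \<and> (\<forall>a\<in>A. g (F a) = f a)"
proof -
  have "\<exists>h. bij_betw h {a \<in> A. f a = k} {b \<in> B. g b = k}" for k
    using fin fibres by (intro finite_same_card_bij) auto
  then obtain h where h: "\<And>k. bij_betw (h k) {a \<in> A. f a = k} {b \<in> B. g b = k}"
    by metis
  define F where "F a = h (f a) a" for a
  have Fk: "bij_betw F {a \<in> A. f a = k} {b \<in> B. g b = k}" for k
    using h[of k] by (rule bij_betw_cong[THEN iffD1, rotated]) (simp add: F_def)
  have "bij_betw F (\<Union>k. {a \<in> A. f a = k}) (\<Union>k. {b \<in> B. g b = k})"
    using Fk by (intro bij_betw_UNION_disjoint) (auto simp: disjoint_family_on_def)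
  moreover have "(\<Union>k. {a \<in> A. f a = k}) = A" "(\<Union>k. {b \<in> B. g b = k}) = B"
    by auto
  moreover have "g (F a) = f a" if "a \<in> A" for a
    using bij_betwE[OF Fk[of "f a"]] that by blast
  ultimately show ?thesis by auto
qed

text \<open>
  The transposition of the image of \<open>a\<^sub>0\<close> with \<open>b\<^sub>0\<close> moves elements of a single fibre
  only, so that composing with it keeps the values.
\<close>

lemma ex_bij_betw_preserving_pointed:
  assumes fin: "finite A" "finite B"
    and fibres: "\<And>k. card {a \<in> A. f a = k} = card {b \<in> B. g b = k}"
    and base: "a\<^sub>0 \<in> A" "b\<^sub>0 \<in> B" "f a\<^sub>0 = g b\<^sub>0"
  shows "\<exists>F. bij_betw F A B \<and> (\<forall>a\<in>A. g (F a) = f a) \<and> F a\<^sub>0 = b\<^sub>0"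
proof -
  obtain F where F: "bij_betw F A B" "\<And>a. a \<in> A \<Longrightarrow> g (F a) = f a"
    using ex_bij_betw_preserving[OF fin fibres] by blast
  define t where "t = Transposition.transpose (F a\<^sub>0) b\<^sub>0"
  have "F a\<^sub>0 \<in> B"
    using F(1) base(1) bij_betwE by blast
  then have "t permutes B"
    unfolding t_def using base(2) by (rule permutes_swap_id)
  then have "bij_betw (t \<circ> F) A B"
    using F(1) permutes_imp_bij bij_betw_trans by blast
  moreover have "g (t b) = g b" for b
    using F(2)[OF base(1)] base(3) by (simp add: t_def Transposition.transpose_def)
  then have "\<forall>a\<in>A. g ((t \<circ> F) a) = f a"
    using F(2) by simp
  moreover have "(t \<circ> F) a\<^sub>0 = b\<^sub>0"
    by (simp add: t_def)
  ultimately show ?thesis by blast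
qed

lemma bij_betw_funpow_orbit:
  assumes "permutation \<sigma>"
  shows "bij_betw (\<lambda>k. (\<sigma> ^^ k) x) {0..<card (orbit \<sigma> x)} (orbit \<sigma> x)"
    and "(\<sigma> ^^ card (orbit \<sigma> x)) x = x"
proof -
  have self: "x \<in> orbit \<sigma> x"
    using assms by (rule permutation_self_in_orbit)
  have bij: "bij_betw (\<lambda>k. (\<sigma> ^^ k) x) {0..<funpow_dist1 \<sigma> x x} (orbit \<sigma> x)"
    using inj_on_funpow_dist1[OF self] orbit_conv_funpow_dist1[OF self]
    by (simp add: bij_betw_def)
  then have card: "card (orbit \<sigma> x) = funpow_dist1 \<sigma> x x"
    using bij_betw_same_card by fastforce
  show "bij_betw (\<lambda>k. (\<sigma> ^^ k) x) {0..<card (orbit \<sigma> x)} (orbit \<sigma> x)"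
    unfolding card by (rule bij)
  show "(\<sigma> ^^ card (orbit \<sigma> x)) x = x"
    unfolding card by (rule funpow_dist1_prop[OF self])
qed

text \<open>
  The identification matches the \<open>k\<close>-th point after \<open>x\<close> with the \<open>k\<close>-th point after \<open>y\<close>, for
  \<open>k\<close> below the common length. It respects the step that closes the cycle exactly because both
  cycles close after the same number of steps.
\<close>

lemma orbit_bij_equivariant:
  assumes perm: "permutation \<sigma>" "permutation \<tau>"
    and card: "card (orbit \<sigma> x) = card (orbit \<tau> y)"
  shows "\<exists>g. bij_betw g (orbit \<sigma> x) (orbit \<tau> y) \<and> g x = y
    \<and> (\<forall>z\<in>orbit \<sigma> x. g (\<sigma> z) = \<tau> (g z))"
proof -
  define m where "m = card (orbit \<sigma> x)"
  define p where "p k = (\<sigma> ^^ k) x" for k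
  define q where "q k = (\<tau> ^^ k) y" for k
  define g where "g z = q (inv_into {0..<m} p z)" for z
  have p: "bij_betw p {0..<m} (orbit \<sigma> x)" "p m = x"
    using bij_betw_funpow_orbit[OF perm(1), of x] by (simp_all add: m_def p_def[abs_def])
  have q: "bij_betw q {0..<m} (orbit \<tau> y)" "q m = y"
    using bij_betw_funpow_orbit[OF perm(2), of y] by (simp_all add: m_def q_def[abs_def] card)
  have "x \<in> orbit \<sigma> x"
    using perm(1) by (rule permutation_self_in_orbit)
  then have "m \<noteq> 0"
    using p(1) by (auto simp: bij_betw_def)
  have g_less: "g (p k) = q k" if "k < m" for k
    using that bij_betw_inv_into_left[OF p(1)] by (simp add: g_def)
  have start: "p 0 = x" "q 0 = y"
    by (simp_all add: p_def q_def)
  then have g_x: "g x = y"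
    using g_less[of 0] \<open>m \<noteq> 0\<close> by simp
  have g_le: "g (p k) = q k" if "k \<le> m" for k
    using that g_less p(2) q(2) g_x by (cases "k = m") auto
  have "bij_betw g (orbit \<sigma> x) (orbit \<tau> y)"
    using bij_betw_trans[OF bij_betw_inv_into[OF p(1)] q(1)] by (simp add: g_def[abs_def] comp_def)
  moreover have "g (\<sigma> z) = \<tau> (g z)" if z: "z \<in> orbit \<sigma> x" for z
  proof -
    have "z \<in> p ` {0..<m}"
      using z bij_betw_imp_surj_on[OF p(1)] by simp
    then obtain k where k: "k < m" "z = p k"
      by auto
    have "\<sigma> (p k) = p (Suc k)" "\<tau> (q k) = q (Suc k)"
      by (simp_all add: p_def q_def)
    then show ?thesis
      using k g_le[of "Suc k"] g_less[of k] by simp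
  qed
  ultimately show ?thesis using g_x by blast
qed

lemma Union_cycle_sets:
  assumes "\<sigma> \<in> Sym n"
  shows "\<Union> (cycle_sets n \<sigma>) = {1..n}"
proof
  show "\<Union> (cycle_sets n \<sigma>) \<subseteq> {1..n}"
    using assms permutes_orbit_subset by (fastforce simp: cycle_sets_def Sym_def)
  show "{1..n} \<subseteq> \<Union> (cycle_sets n \<sigma>)"
    using permutation_self_in_orbit[OF Sym_permutation[OF assms]]
    unfolding cycle_sets_eq_image by blast
qed

lemma cycle_sets_eq_orbit:
  assumes "\<sigma> \<in> Sym n" "C \<in> cycle_sets n \<sigma>" "z \<in> C"
  shows "orbit \<sigma> z = C"
  using assms cyclic_on_orbit'[OF Sym_permutation] orbit_cyclic_eq3
  by (fastforce simp: cycle_sets_def)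

lemma relabel_if_same_cycle_data:
  assumes \<sigma>: "\<sigma> \<in> Sym n" and \<tau>: "\<tau> \<in> Sym n" and i: "i \<in> {1..n}" and j: "j \<in> {1..n}"
    and type: "cycle_type n \<sigma> = cycle_type n \<tau>"
    and len: "cycle_length i \<sigma> = cycle_length j \<tau>"
  shows "\<exists>\<alpha>\<in>Sym n. (j, \<tau>) = relabel \<alpha> (i, \<sigma>)"
proof -
  have "\<exists>F. bij_betw F (cycle_sets n \<sigma>) (cycle_sets n \<tau>)
      \<and> (\<forall>C\<in>cycle_sets n \<sigma>. card (F C) = card C) \<and> F (orbit \<sigma> i) = orbit \<tau> j"
  proof (rule ex_bij_betw_preserving_pointed)
    show "card {C \<in> cycle_sets n \<sigma>. card C = k} = card {D \<in> cycle_sets n \<tau>. card D = k}" for k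
      using num_cycles_eq_if_cycle_type_eq[OF \<sigma> \<tau> type] by (simp add: num_cycles_def)
  qed (use i j len in \<open>auto simp: cycle_sets_def cycle_length_def\<close>)
  then obtain F where F: "bij_betw F (cycle_sets n \<sigma>) (cycle_sets n \<tau>)"
    and F_card: "\<And>C. C \<in> cycle_sets n \<sigma> \<Longrightarrow> card (F C) = card C"
    and F_i: "F (orbit \<sigma> i) = orbit \<tau> j"
    by blast
  \<comment> \<open>The marked cycle is identified from its marked point, any other one from arbitrary points.\<close>
  have "\<exists>g. bij_betw g C (F C) \<and> (\<forall>z\<in>C. g (\<sigma> z) = \<tau> (g z)) \<and> (C = orbit \<sigma> i \<longrightarrow> g i = j)"
    if C: "C \<in> cycle_sets n \<sigma>" for C
  proof -
    have "F C \<in> cycle_sets n \<tau>"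
      using F C bij_betwE by blast
    then obtain x y where "C = orbit \<sigma> x" "F C = orbit \<tau> y" "C = orbit \<sigma> i \<longrightarrow> x = i \<and> y = j"
      using C F_i by (cases "C = orbit \<sigma> i") (auto simp: cycle_sets_def)
    then show ?thesis
      using orbit_bij_equivariant[OF Sym_permutation[OF \<sigma>] Sym_permutation[OF \<tau>], of x y] F_card[OF C]
      by auto
  qed
  then obtain g where g: "\<And>C. C \<in> cycle_sets n \<sigma> \<Longrightarrow> bij_betw (g C) C (F C)"
    and g_step: "\<And>C z. C \<in> cycle_sets n \<sigma> \<Longrightarrow> z \<in> C \<Longrightarrow> g C (\<sigma> z) = \<tau> (g C z)"
    and g_i: "g (orbit \<sigma> i) i = j"
    using i by (metis (mono_tags, lifting) cycle_sets_def mem_Collect_eq)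
  define \<alpha> where "\<alpha> z = (if z \<in> {1..n} then g (orbit \<sigma> z) z else z)" for z
  have \<alpha>_on: "\<alpha> z = g C z" if "C \<in> cycle_sets n \<sigma>" "z \<in> C" for C z
    using that Union_cycle_sets[OF \<sigma>] cycle_sets_eq_orbit[OF \<sigma>] by (auto simp: \<alpha>_def)
  have \<alpha>_bij: "bij_betw \<alpha> C (F C)" if "C \<in> cycle_sets n \<sigma>" for C
    using g[OF that] by (rule bij_betw_cong[THEN iffD1, rotated]) (simp add: \<alpha>_on[OF that])
  have "bij_betw \<alpha> (\<Union>C\<in>cycle_sets n \<sigma>. C) (\<Union>C\<in>cycle_sets n \<sigma>. F C)"
  proof (rule bij_betw_UNION_disjoint)
    show "disjoint_family_on F (cycle_sets n \<sigma>)"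
      unfolding disjoint_family_on_def
    proof (intro ballI impI)
      fix C D assume CD: "C \<in> cycle_sets n \<sigma>" "D \<in> cycle_sets n \<sigma>" "C \<noteq> D"
      then have "F C \<noteq> F D" "F C \<in> cycle_sets n \<tau>" "F D \<in> cycle_sets n \<tau>"
        using F by (auto simp: bij_betw_def inj_on_def)
      then show "F C \<inter> F D = {}"
        using cycle_sets_eq_orbit[OF \<tau>] by blast
    qed
  qed (rule \<alpha>_bij)
  moreover have "(\<Union>C\<in>cycle_sets n \<sigma>. F C) = \<Union> (cycle_sets n \<tau>)"
    using F by (simp add: bij_betw_def)
  ultimately have "bij_betw \<alpha> {1..n} {1..n}"
    using Union_cycle_sets[OF \<sigma>] Union_cycle_sets[OF \<tau>] by simp
  then have \<alpha>: "\<alpha> \<in> Sym n"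
    unfolding Sym_def by (auto intro!: bij_imp_permutes simp: \<alpha>_def)
  have step: "\<alpha> (\<sigma> z) = \<tau> (\<alpha> z)" for z
  proof (cases "z \<in> {1..n}")
    case True
    then have C: "orbit \<sigma> z \<in> cycle_sets n \<sigma>"
      by (auto simp: cycle_sets_def)
    have "z \<in> orbit \<sigma> z" "\<sigma> z \<in> orbit \<sigma> z"
      using permutation_self_in_orbit[OF Sym_permutation[OF \<sigma>]] orbit.base by auto
    then show ?thesis
      using \<alpha>_on[OF C] g_step[OF C] by simp
  next
    case False
    then have "\<sigma> z = z" "\<tau> z = z"
      using \<sigma> \<tau> permutes_not_in by (fastforce simp: Sym_def)+
    then show ?thesis using False by (auto simp: \<alpha>_def)
  qed
  have "inv \<alpha> \<cdot> \<sigma> \<cdot> \<alpha> = \<tau>"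
    using step Sym_bij[OF \<alpha>] by (simp add: fun_eq_iff bij_is_surj surj_f_inv_f)
  moreover have "\<alpha> i = j"
    using i g_i by (simp add: \<alpha>_def)
  ultimately show ?thesis
    using \<alpha> by auto
qed

section \<open>Equivalence of the three conditions\<close>

theorem proposition4p4:
  fixes n i j :: nat and \<sigma> \<tau> :: "nat \<Rightarrow> nat"
  assumes "n > 0"
    and "(i, \<sigma>) \<in> QS n"
    and "(j, \<tau>) \<in> QS n"
  shows "((\<exists>\<alpha>\<in>Sym n. j = \<alpha> i \<and> \<tau> = inv \<alpha> \<cdot> \<sigma> \<cdot> \<alpha>) \<longleftrightarrow>
          (cycle_type n \<sigma> = cycle_type n \<tau> \<and> cycle_length i \<sigma> = cycle_length j \<tau>))
       \<and> ((cycle_type n \<sigma> = cycle_type n \<tau> \<and> cycle_length i \<sigma> = cycle_length j \<tau>) \<longleftrightarrow>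
          (\<exists>C\<in>connected_components (QS n) QS_op. (i, \<sigma>) \<in> C \<and> (j, \<tau>) \<in> C))"
proof -
  have mem: "\<sigma> \<in> Sym n" "\<tau> \<in> Sym n" "i \<in> {1..n}" "j \<in> {1..n}"
    using assms(2,3) by (auto simp: QS_def)
  have "(\<exists>\<alpha>\<in>Sym n. j = \<alpha> i \<and> \<tau> = inv \<alpha> \<cdot> \<sigma> \<cdot> \<alpha>) \<longleftrightarrow> (\<exists>\<alpha>\<in>Sym n. (j, \<tau>) = relabel \<alpha> (i, \<sigma>))"
    by simp
  moreover have "(\<exists>\<alpha>\<in>Sym n. (j, \<tau>) = relabel \<alpha> (i, \<sigma>)) \<longleftrightarrow>
      cycle_type n \<sigma> = cycle_type n \<tau> \<and> cycle_length i \<sigma> = cycle_length j \<tau>"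
    using same_cycle_data_if_relabel[OF mem(1)] relabel_if_same_cycle_data[OF mem] by blast
  ultimately show ?thesis
    using same_component_iff_relabel[OF assms(2,3)] by blast
qed

end
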